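(* Let $m,n,w,x,y,z\in\mathbb Z$ with $w+x=y+z$ and $m,n\ge 0$. Then $$\binom{w+m}{w}\binom{y+m}{x}\binom{w+n}{y}\binom{z+n}{z}=\sum_{\substack{0\le i\le m\\ 0\le j\le n}}\binom{w+i+n}{w+i+j}\binom{w+m+j}{i,\ j,\ m-i,\ x-i-j,\ z-x+j,\ y-x+i}.$$
   Context: Binomial coefficients $\binom{a}{b}$ equal $\frac{a!}{b!(a-b)!}$ if $0\le b\le a$ and are $0$ otherwise. Multinomial coefficients $\binom{N}{k_1,\dots,k_r}$ (with $k_1+\dots+k_r=N$) equal $\frac{N!}{k_1!\cdots k_r!}$ if all $k_s\ge0$, and are $0$ if some $k_s<0$. *)

theory Defs
  imports Complex_Main
begin

text \<open>The library's \<^const>\<open>gbinomial\<close> is nonzero at negative upper arguments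
  (for instance at upper argument -1), so it is not the convention used here.\<close>

definition ibinom :: "int \<Rightarrow> int \<Rightarrow> rat" where
  "ibinom a b =
     (if 0 \<le> b \<and> b \<le> a then of_nat (nat a choose nat b) else 0)"

lemma ibinom_fact:
  "ibinom a b =
     (if 0 \<le> b \<and> b \<le> a then fact (nat a) / (fact (nat b) * fact (nat (a - b))) else 0)"
  by (simp add: ibinom_def binomial_fact nat_diff_distrib nat_mono)

text \<open>Only meaningful when \<open>sum_list ks = N\<close>. The values are rational so that the
  division is the exact one.\<close>

definition multinom :: "int \<Rightarrow> int list \<Rightarrow> rat" where
  "multinom N ks =
     (if \<forall>k\<in>set ks. 0 \<le> k
      then fact (nat N) / (\<Prod>k\<leftarrow>ks. fact (nat k)) else 0)"

end

theory Submission
  imports Defs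
begin

text \<open>In terms of factorials the summand on the right is a product of
  \<open>(w + i + n)!\<close>, \<open>(w + m + j)!\<close> and reciprocal factorials of linear forms in \<open>i\<close> and \<open>j\<close>.
  With \<open>1/k!\<close> read as \<open>0\<close> for negative \<open>k\<close>, both the vanishing conventions and the summation
  bounds are encoded by these reciprocals, and the Vandermonde convolution takes the symmetric
  form \<open>vandermonde_rfact\<close>, valid for arbitrary integer parameters.

  Read from right to left, that convolution expands
  \<open>(w + m + j)! / (j! (w + i + j)! (m - i)!)\<close> as a sum over a new index \<open>s\<close>. What depends on
  \<open>j\<close> is then again a product of four reciprocal factorials, and Vandermonde sums it. The sum
  over \<open>i\<close> that remains for fixed \<open>s\<close> is, up to a constant factor, the terminating
  hypergeometric series \<open>3F2(-s, -z, w+n+1; w-z+1, n-s+1; 1)\<close>; because \<open>y - x = w - z\<close>, it is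
  balanced, and the Pfaff-Saalschuetz summation (\<open>saalschuetz_rfact\<close>) gives its value in
  closed form. What is left is a last Vandermonde sum, over \<open>s\<close>, whose value completes the
  product of the four binomial coefficients.\<close>

section \<open>Reciprocal factorials on the integers\<close>

definition rfact :: "int \<Rightarrow> rat" where
  "rfact k = (if 0 \<le> k then 1 / fact (nat k) else 0)"

lemma rfact_neg [simp]: "k < 0 \<Longrightarrow> rfact k = 0"
  by (simp add: rfact_def)

lemma fact_rfact [simp]: "0 \<le> k \<Longrightarrow> fact (nat k) * rfact k = 1"
  by (simp add: rfact_def)

lemma ibinom_rfact:
  assumes "0 \<le> a"
  shows "ibinom a b = fact (nat a) * rfact b * rfact (a - b)"
  using assms by (auto simp: ibinom_fact rfact_def)

lemma multinom_rfact: "multinom N ks = fact (nat N) * (\<Prod>k\<leftarrow>ks. rfact k)"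
proof (cases "\<forall>k\<in>set ks. 0 \<le> k")
  case True
  then have "(\<Prod>k\<leftarrow>ks. rfact k) = 1 / (\<Prod>k\<leftarrow>ks. fact (nat k))"
    by (induction ks) (auto simp: rfact_def)
  with True show ?thesis by (simp add: multinom_def)
next
  case False
  then have "(\<Prod>k\<leftarrow>ks. rfact k) = 0"
    by (induction ks) (auto simp: rfact_def)
  with False show ?thesis by (auto simp: multinom_def)
qed

lemma rfact_binomial:
  "rfact (int k) * rfact (int p - int k) = of_nat (p choose k) / fact p"
proof (cases "k \<le> p")
  case True
  then have "nat (int p - int k) = p - k" by linarith
  with True show ?thesis by (simp add: rfact_def binomial_fact)
qed (simp add: rfact_def)

section \<open>Vandermonde and Pfaff-Saalschuetz\<close>

text \<open>Up to factors free of \<open>j\<close>, the four reciprocals pair up as \<open>binom(b-a, j-a)\<close> and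
  \<open>binom(c-d, c-j)\<close>, so this is the usual convolution with sum \<open>binom(b+c-a-d, c-a)\<close>. The summand vanishes outside the
  interval \<open>{max a d..min b c}\<close>, so any finite set that contains it may serve as index
  set.\<close>

lemma vandermonde_rfact:
  assumes "finite A" and sub: "{max a d..min b c} \<subseteq> A"
  shows "(\<Sum>j\<in>A. rfact (j - a) * rfact (j - d) * rfact (b - j) * rfact (c - j)) =
    fact (nat (b + c - a - d)) * rfact (b - a) * rfact (b - d) * rfact (c - a) * rfact (c - d)"
    (is "sum ?t A = ?R")
proof (cases "a \<le> b \<and> d \<le> c \<and> a \<le> c")
  case False
  then have "?t j = 0" for j by (auto simp: rfact_def)
  then have "sum ?t A = 0" by (intro sum.neutral ballI)
  moreover have "?R = 0" using False by auto
  ultimately show ?thesis by simp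
next
  case True
  define p q r where "p = nat (b - a)" "q = nat (c - d)" "r = nat (c - a)"
  have pqr: "b = a + int p" "c = a + int r" "d = a + int r - int q"
    using True by (auto simp: p_q_r_def)
  have "sum ?t A = sum ?t {max a d..min b c}"
    using assms by (intro sum.mono_neutral_right) (auto simp: rfact_def)
  also have "\<dots> = sum ?t {a..c}"
    by (intro sum.mono_neutral_left) (auto simp: rfact_def)
  also have "\<dots> = (\<Sum>k\<le>r. ?t (a + int k))"
    by (rule sum.reindex_bij_witness[where i = "\<lambda>k. a + int k" and j = "\<lambda>j. nat (j - a)"])
      (auto simp: pqr)
  also have "\<dots> = (\<Sum>k\<le>r. of_nat ((p choose k) * (q choose (r - k))) / (fact p * fact q))"
  proof (rule sum.cong)
    fix k assume "k \<in> {..r}"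
    then have "int (r - k) = int r - int k" by auto
    then have "?t (a + int k) = (rfact (int k) * rfact (int p - int k)) *
        (rfact (int (r - k)) * rfact (int q - int (r - k)))"
      by (simp add: pqr algebra_simps)
    then show "?t (a + int k) =
        of_nat ((p choose k) * (q choose (r - k))) / (fact p * fact q)"
      by (simp add: rfact_binomial)
  qed simp
  also have "\<dots> = of_nat ((p + q) choose r) / (fact p * fact q)"
    by (simp add: vandermonde[symmetric] sum_divide_distrib)
  also have "\<dots> = fact (p + q) * (rfact (int r) * rfact (int (p + q) - int r)) *
      (rfact (int p) * rfact (int q))"
    unfolding rfact_binomial by (simp add: rfact_def)
  also have "\<dots> = ?R"
  proof -
    have "b + c - a - d = int (p + q)" "b - a = int p" "b - d = int (p + q) - int r"
      "c - a = int r" "c - d = int q" by (simp_all add: pqr)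
    then show ?thesis by (simp only: nat_int mult_ac)
  qed
  finally show ?thesis .
qed

text \<open>In binomial coefficients this reads
  \<open>\<Sum>i. binom(s, i) binom(w, z-i) binom(w+n+i, w+s) = binom(z+n, n) binom(w+n, w+s-z)\<close>. Expanding
  the factor with the moving upper argument by Vandermonde in an index \<open>t\<close> makes the
  sum over \<open>i\<close> a Vandermonde sum; its value contains \<open>(w+s-t)!\<close>, which cancels the one
  reciprocal factorial in the way of the Vandermonde sum over \<open>t\<close>.\<close>

lemma saalschuetz_rfact:
  fixes m n s w z :: int
  assumes "0 \<le> w" "0 \<le> n" "0 \<le> s" "s \<le> m"
  shows "(\<Sum>i\<in>{0..m}. fact (nat (w + n + i)) * rfact i * rfact (s - i) * rfact (w - z + i) *
      rfact (n - s + i) * rfact (z - i)) =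
    fact (nat (w + s)) * fact (nat (z + n)) * fact (nat (w + n)) *
      rfact w * rfact n * rfact z * rfact s * rfact (z + n - s) * rfact (w - z + s)"
    (is "?L = ?R")
proof -
  define F where "F = (fact (nat (w + s)) * fact (nat (w + n)) :: rat)"
  have F: "F * (rfact (w + s) * rfact (w + n)) = 1"
    using assms fact_rfact[of "w + s"] fact_rfact[of "w + n"]
    unfolding F_def by (metis add_nonneg_nonneg mult.assoc mult.left_commute mult_1_right)
  have expand: "fact (nat (w + n + i)) * rfact i * rfact (n - s + i) =
      F * (\<Sum>t\<in>{0..m}. rfact t * rfact (t - (s - n)) * rfact (i - t) * rfact (w + s - t))"
    if "i \<in> {0..m}" for i
  proof -
    have "(\<Sum>t\<in>{0..m}. rfact (t - 0) * rfact (t - (s - n)) * rfact (i - t) * rfact (w + s - t)) =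
        fact (nat (i + (w + s) - 0 - (s - n))) * rfact (i - 0) * rfact (i - (s - n)) *
        rfact (w + s - 0) * rfact (w + s - (s - n))"
      using that by (intro vandermonde_rfact) auto
    then have "F * (\<Sum>t\<in>{0..m}. rfact t * rfact (t - (s - n)) * rfact (i - t) * rfact (w + s - t)) =
        (F * (rfact (w + s) * rfact (w + n))) *
        (fact (nat (w + n + i)) * rfact i * rfact (n - s + i))"
      by (simp add: algebra_simps)
    with F show ?thesis by simp
  qed
  have inner: "rfact (w + s - t) *
      (\<Sum>i\<in>{0..m}. rfact (i - t) * rfact (i - (z - w)) * rfact (s - i) * rfact (z - i)) =
      rfact (s - t) * rfact (w - z + s) * rfact (z - t) * rfact w"
    if "t \<in> {0..m}" for t
  proof -
    have "(\<Sum>i\<in>{0..m}. rfact (i - t) * rfact (i - (z - w)) * rfact (s - i) * rfact (z - i)) =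
        fact (nat (s + z - t - (z - w))) * rfact (s - t) * rfact (s - (z - w)) *
        rfact (z - t) * rfact (z - (z - w))"
      using that assms by (intro vandermonde_rfact) auto
    then have *: "rfact (w + s - t) *
        (\<Sum>i\<in>{0..m}. rfact (i - t) * rfact (i - (z - w)) * rfact (s - i) * rfact (z - i)) =
        (fact (nat (w + s - t)) * rfact (w + s - t)) *
        (rfact (s - t) * rfact (w - z + s) * rfact (z - t) * rfact w)"
      by (simp add: algebra_simps)
    show ?thesis
    proof (cases "t \<le> s")
      case True
      with assms have "0 \<le> w + s - t" by simp
      with * show ?thesis by simp
    qed (simp add: *)
  qed
  have outer: "(\<Sum>t\<in>{0..m}. rfact t * rfact (t - (s - n)) * rfact (s - t) * rfact (z - t)) =
      fact (nat (z + n)) * rfact s * rfact n * rfact z * rfact (z + n - s)"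
  proof -
    have "(\<Sum>t\<in>{0..m}. rfact (t - 0) * rfact (t - (s - n)) * rfact (s - t) * rfact (z - t)) =
        fact (nat (s + z - 0 - (s - n))) * rfact (s - 0) * rfact (s - (s - n)) *
        rfact (z - 0) * rfact (z - (s - n))"
      using assms by (intro vandermonde_rfact) auto
    then show ?thesis by (simp add: algebra_simps)
  qed
  have "?L = (\<Sum>i\<in>{0..m}. (fact (nat (w + n + i)) * rfact i * rfact (n - s + i)) *
      (rfact (s - i) * rfact (i - (z - w)) * rfact (z - i)))"
    by (intro sum.cong refl) (simp add: algebra_simps)
  also have "\<dots> = (\<Sum>i\<in>{0..m}. \<Sum>t\<in>{0..m}. F * (rfact t * rfact (t - (s - n))) *
      (rfact (w + s - t) *
        (rfact (i - t) * rfact (i - (z - w)) * rfact (s - i) * rfact (z - i))))"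
    by (intro sum.cong refl, subst expand)
      (auto simp: sum_distrib_left sum_distrib_right mult_ac)
  also have "\<dots> = (\<Sum>t\<in>{0..m}. F * (rfact t * rfact (t - (s - n))) *
      (rfact (w + s - t) *
        (\<Sum>i\<in>{0..m}. rfact (i - t) * rfact (i - (z - w)) * rfact (s - i) * rfact (z - i))))"
    by (subst sum.swap) (simp add: sum_distrib_left)
  also have "\<dots> = (\<Sum>t\<in>{0..m}. F * rfact (w - z + s) * rfact w *
      (rfact t * rfact (t - (s - n)) * rfact (s - t) * rfact (z - t)))"
    by (intro sum.cong refl, subst inner) (auto simp: mult_ac)
  also have "\<dots> = F * rfact (w - z + s) * rfact w *
      (\<Sum>t\<in>{0..m}. rfact t * rfact (t - (s - n)) * rfact (s - t) * rfact (z - t))"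
    by (simp add: sum_distrib_left)
  also have "\<dots> = ?R"
    unfolding outer F_def by (simp only: mult_ac)
  finally show ?thesis .
qed

section \<open>The double sum\<close>

lemma double_sum_nonneg:
  fixes m n w x y z :: int
  assumes wx: "w + x = y + z"
    and nonneg: "0 \<le> m" "0 \<le> n" "0 \<le> w" "0 \<le> x" "0 \<le> y" "0 \<le> z"
  shows "ibinom (w + m) w * ibinom (y + m) x * ibinom (w + n) y * ibinom (z + n) z =
    (\<Sum>i\<in>{0..m}. \<Sum>j\<in>{0..n}.
       ibinom (w + i + n) (w + i + j) *
       multinom (w + m + j) [i, j, m - i, x - i - j, z - x + j, y - x + i])"
    (is "?L = ?R")
proof -
  define G where "G i = fact (nat (w + n + i)) * rfact i * rfact (y - x + i)" for i
  define M where "M = (fact (nat (w + m)) :: rat)"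
  have yx: "y - x = w - z" using wx by auto
  have expand: "fact (nat (w + m + j)) * rfact j * rfact (w + i + j) * rfact (m - i) =
      M * (\<Sum>s\<in>{0..m}. rfact (s - i) * rfact (w + s) * rfact (i + j - s) * rfact (m - s))"
    if "i \<in> {0..m}" for i j
  proof -
    have "(\<Sum>s\<in>{0..m}. rfact (s - i) * rfact (s - (- w)) * rfact (i + j - s) * rfact (m - s)) =
        fact (nat (i + j + m - i - (- w))) * rfact (i + j - i) * rfact (i + j - (- w)) *
        rfact (m - i) * rfact (m - (- w))"
      using that by (intro vandermonde_rfact) auto
    then have "M * (\<Sum>s\<in>{0..m}. rfact (s - i) * rfact (w + s) * rfact (i + j - s) * rfact (m - s)) =
        (M * rfact (w + m)) *
        (fact (nat (w + m + j)) * rfact j * rfact (w + i + j) * rfact (m - i))"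
      by (simp add: algebra_simps)
    with nonneg show ?thesis by (simp add: M_def)
  qed
  \<comment> \<open>The factor \<open>rfact (s - i)\<close> is kept on both sides because for \<open>s < i\<close> the support of the
    sum over \<open>j\<close> need not lie in \<open>{0..n}\<close>.\<close>
  have sum_j: "rfact (s - i) * (\<Sum>j\<in>{0..n}. rfact (j - (s - i)) * rfact (j - (y - w)) *
        rfact (n - j) * rfact (x - i - j)) =
      rfact (s - i) * (fact (nat (z + n - s)) * rfact (n - s + i) * rfact (w + n - y) *
        rfact (x - s) * rfact (z - i))" for i s
  proof (cases "i \<le> s")
    case True
    have "(\<Sum>j\<in>{0..n}. rfact (j - (s - i)) * rfact (j - (y - w)) *
          rfact (n - j) * rfact (x - i - j)) =
        fact (nat (n + (x - i) - (s - i) - (y - w))) * rfact (n - (s - i)) * rfact (n - (y - w)) *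
          rfact (x - i - (s - i)) * rfact (x - i - (y - w))"
      using True by (intro vandermonde_rfact) auto
    moreover have "n + (x - i) - (s - i) - (y - w) = z + n - s" "x - i - (y - w) = z - i"
      using wx by auto
    ultimately show ?thesis by (simp add: algebra_simps)
  qed simp
  \<comment> \<open>When \<open>z + n < s\<close>, the factorial below is a junk value; then \<open>x - s\<close> or \<open>z + n - x\<close> is negative.\<close>
  have cancel: "fact (nat (z + n - s)) * rfact (z + n - s) * (rfact (w + n - y) * rfact (x - s)) =
      rfact (w + n - y) * rfact (x - s)" for s
  proof (cases "s \<le> z + n")
    case False
    then have "w + n - y < 0 \<or> x - s < 0" using wx by linarith
    then show ?thesis by auto
  qed simp
  have sum_s: "(\<Sum>s\<in>{0..m}. rfact s * rfact (y - x + s) * rfact (m - s) * rfact (x - s)) =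
      fact (nat (y + m)) * rfact m * rfact (y + m - x) * rfact x * rfact y"
  proof -
    have "(\<Sum>s\<in>{0..m}. rfact (s - 0) * rfact (s - (x - y)) * rfact (m - s) * rfact (x - s)) =
        fact (nat (m + x - 0 - (x - y))) * rfact (m - 0) * rfact (m - (x - y)) *
        rfact (x - 0) * rfact (x - (x - y))"
      by (intro vandermonde_rfact) auto
    then show ?thesis by (simp add: algebra_simps)
  qed
  have "?R = (\<Sum>i\<in>{0..m}. \<Sum>j\<in>{0..n}. G i * (rfact (n - j) * rfact (x - i - j) *
      rfact (j - (y - w))) *
      (fact (nat (w + m + j)) * rfact j * rfact (w + i + j) * rfact (m - i)))"
  proof (intro sum.cong refl)
    fix i j assume ij: "i \<in> {0..m}" "j \<in> {0..n}"
    have shift: "z - x + j = j - (y - w)" using wx by auto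
    have "ibinom (w + i + n) (w + i + j) =
        fact (nat (w + n + i)) * rfact (w + i + j) * rfact (n - j)"
      using ij nonneg by (subst ibinom_rfact) (auto simp: algebra_simps)
    moreover have "multinom (w + m + j) [i, j, m - i, x - i - j, z - x + j, y - x + i] =
        fact (nat (w + m + j)) * (rfact i * (rfact j * (rfact (m - i) *
          (rfact (x - i - j) * (rfact (j - (y - w)) * rfact (y - x + i))))))"
      unfolding multinom_rfact shift by simp
    ultimately show "ibinom (w + i + n) (w + i + j) *
        multinom (w + m + j) [i, j, m - i, x - i - j, z - x + j, y - x + i] =
        G i * (rfact (n - j) * rfact (x - i - j) * rfact (j - (y - w))) *
        (fact (nat (w + m + j)) * rfact j * rfact (w + i + j) * rfact (m - i))"
      by (simp only: G_def mult_ac)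
  qed
  also have "\<dots> = (\<Sum>i\<in>{0..m}. \<Sum>j\<in>{0..n}. \<Sum>s\<in>{0..m}.
      M * G i * rfact (w + s) * rfact (m - s) * (rfact (s - i) *
        (rfact (j - (s - i)) * rfact (j - (y - w)) * rfact (n - j) * rfact (x - i - j))))"
  proof (intro sum.cong refl, subst expand)
    fix i j :: int
    have "i + j - s = j - (s - i)" for s by simp
    then show "G i * (rfact (n - j) * rfact (x - i - j) * rfact (j - (y - w))) *
        (M * (\<Sum>s\<in>{0..m}. rfact (s - i) * rfact (w + s) * rfact (i + j - s) * rfact (m - s))) =
      (\<Sum>s\<in>{0..m}. M * G i * rfact (w + s) * rfact (m - s) * (rfact (s - i) *
        (rfact (j - (s - i)) * rfact (j - (y - w)) * rfact (n - j) * rfact (x - i - j))))"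
      by (simp only: sum_distrib_left mult_ac)
  qed
  also have "\<dots> = (\<Sum>i\<in>{0..m}. \<Sum>s\<in>{0..m}. M * G i * rfact (w + s) * rfact (m - s) *
      (rfact (s - i) * (\<Sum>j\<in>{0..n}. rfact (j - (s - i)) * rfact (j - (y - w)) *
        rfact (n - j) * rfact (x - i - j))))"
    by (rule sum.cong[OF refl], subst sum.swap) (simp add: sum_distrib_left)
  also have "\<dots> = (\<Sum>s\<in>{0..m}. \<Sum>i\<in>{0..m}. M * rfact (w + s) * rfact (m - s) *
      fact (nat (z + n - s)) * rfact (w + n - y) * rfact (x - s) *
      (fact (nat (w + n + i)) * rfact i * rfact (s - i) * rfact (w - z + i) *
        rfact (n - s + i) * rfact (z - i)))"
    unfolding sum_j by (subst sum.swap) (simp add: G_def yx mult_ac)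
  also have "\<dots> = (\<Sum>s\<in>{0..m}. M * fact (nat (w + n)) * fact (nat (z + n)) *
      rfact w * rfact n * rfact z * rfact (w + n - y) *
      (rfact s * rfact (y - x + s) * rfact (m - s) * rfact (x - s)))"
  proof (intro sum.cong refl)
    fix s assume s: "s \<in> {0..m}"
    let ?C = "M * fact (nat (w + n)) * fact (nat (z + n)) * rfact w * rfact n * rfact z *
      rfact s * rfact (y - x + s) * rfact (m - s)"
    have "(\<Sum>i\<in>{0..m}. M * rfact (w + s) * rfact (m - s) *
        fact (nat (z + n - s)) * rfact (w + n - y) * rfact (x - s) *
        (fact (nat (w + n + i)) * rfact i * rfact (s - i) * rfact (w - z + i) *
          rfact (n - s + i) * rfact (z - i))) =
      ?C * (fact (nat (w + s)) * rfact (w + s)) *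
        (fact (nat (z + n - s)) * rfact (z + n - s) * (rfact (w + n - y) * rfact (x - s)))"
      using s nonneg
      by (subst sum_distrib_left[symmetric], subst saalschuetz_rfact) (auto simp: yx mult_ac)
    also have "\<dots> = ?C * (rfact (w + n - y) * rfact (x - s))"
      unfolding cancel using s nonneg by simp
    finally show "(\<Sum>i\<in>{0..m}. M * rfact (w + s) * rfact (m - s) *
        fact (nat (z + n - s)) * rfact (w + n - y) * rfact (x - s) *
        (fact (nat (w + n + i)) * rfact i * rfact (s - i) * rfact (w - z + i) *
          rfact (n - s + i) * rfact (z - i))) =
      M * fact (nat (w + n)) * fact (nat (z + n)) * rfact w * rfact n * rfact z *
        rfact (w + n - y) * (rfact s * rfact (y - x + s) * rfact (m - s) * rfact (x - s))"
      by (simp only: mult_ac)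
  qed
  also have "\<dots> = M * fact (nat (w + n)) * fact (nat (z + n)) *
      rfact w * rfact n * rfact z * rfact (w + n - y) *
      (fact (nat (y + m)) * rfact m * rfact (y + m - x) * rfact x * rfact y)"
    by (simp only: sum_distrib_left[symmetric] sum_s)
  also have "\<dots> = ?L"
    using nonneg by (simp add: ibinom_rfact M_def mult_ac)
  finally show ?thesis by simp
qed

text \<open>If one of \<open>w\<close>, \<open>x\<close>, \<open>y\<close>, \<open>z\<close> is negative, both sides are zero: each of the four is a sum of
  lower entries of the multinomial coefficient, so in every term one of these entries is
  negative.\<close>

theorem theorem10:
  fixes m n w x y z :: int
  assumes "w + x = y + z" and "m \<ge> 0" and "n \<ge> 0"
  shows "ibinom (w + m) w * ibinom (y + m) x * ibinom (w + n) y * ibinom (z + n) z =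
    (\<Sum>i\<in>{0..m}. \<Sum>j\<in>{0..n}.
       ibinom (w + i + n) (w + i + j) *
       multinom (w + m + j) [i, j, m - i, x - i - j, z - x + j, y - x + i])"
proof (cases "0 \<le> w \<and> 0 \<le> x \<and> 0 \<le> y \<and> 0 \<le> z")
  case True
  with assms show ?thesis by (intro double_sum_nonneg) auto
next
  case False
  have "multinom (w + m + j) [i, j, m - i, x - i - j, z - x + j, y - x + i] = 0"
    if "i \<in> {0..m}" "j \<in> {0..n}" for i j
  proof -
    have "\<not> (0 \<le> x - i - j \<and> 0 \<le> z - x + j \<and> 0 \<le> y - x + i)"
      using False that assms by auto
    then show ?thesis by (auto simp: multinom_def)
  qed
  then have "(\<Sum>i\<in>{0..m}. \<Sum>j\<in>{0..n}.
       ibinom (w + i + n) (w + i + j) *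
       multinom (w + m + j) [i, j, m - i, x - i - j, z - x + j, y - x + i]) = 0"
    by (intro sum.neutral ballI) simp
  moreover have "ibinom (w + m) w * ibinom (y + m) x * ibinom (w + n) y * ibinom (z + n) z = 0"
    using False by (auto simp: ibinom_def)
  ultimately show ?thesis by simp
qed

end
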